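(* Let $a,b,c$ be positive integers such that $b^2+4c$ is prime and $b^2+4c>a$. Let $(u_n)_{n\geq 0}$ be defined by $u_0=0$, $u_1=1$, and $u_n=bu_{n-1}+cu_{n-2}$ for all $n\geq 2$. Then there are at most finitely many primes $p$ for which $\varphi(au_p)$ is a factorial (i.e. $\varphi(au_p)=k!$ for some positive integer $k$). Moreover, every such prime $p$ satisfies $$p\leq \max\left\{e\,a^{1/2}\left(\frac{b+\sqrt{b^2+4c}}{2}\right),\ \frac{\frac{10}{9}\log\big(8\cdot(b^2+4c-1)!\big)-\log a+\frac{\log(b^2+4c)}{2}}{\log\left(\frac{b+\sqrt{b^2+4c}}{2}\right)}\right\}.$$
   Context: $\varphi$ denotes Euler's totient function; $e$ is the base of the natural logarithm and $\log$ the natural logarithm. *)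

theory Defs
  imports Complex_Main "HOL-Number_Theory.Number_Theory"
begin

end

theory Submission
  imports Defs
begin

text \<open>
  Put \<open>D = b\<^sup>2 + 4c\<close> and let \<open>\<alpha>\<close> be the dominant root of \<open>X\<^sup>2 - bX - c\<close>. Suppose that the
  totient of \<open>a u\<^sub>p\<close> is \<open>k!\<close>. If \<open>k < D\<close>, then \<open>n \<le> (8 \<phi>(n))\<^bsup>10/9\<^esup>\<close> bounds \<open>a u\<^sub>p\<close>, hence
  \<open>p\<close>, in terms of \<open>(D - 1)!\<close>. If \<open>k \<ge> D\<close> and \<open>p \<noteq> D\<close>, then \<open>D\<close> divides the totient but not
  \<open>a u\<^sub>p\<close>, so some prime \<open>q \<equiv> 1\<close> modulo \<open>D\<close> divides \<open>u\<^sub>p\<close>. By quadratic reciprocity \<open>D\<close> is a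
  square modulo \<open>q\<close>, so the quotient of the two roots modulo \<open>q\<close> is an element of order \<open>p\<close> and
  \<open>p\<close> divides \<open>q - 1\<close>, which divides \<open>k!\<close>. Hence \<open>(p/e)\<^sup>p \<le> p! \<le> k! \<le> a \<alpha>\<^sup>p\<close>. The prime
  \<open>p = D\<close> satisfies the second bound for reasons of size.
\<close>

section \<open>The totient function and the factorial\<close>

text \<open>By the product formula for \<open>totient n\<close>, the prime \<open>d\<close> divides
  either a power of some prime \<open>q\<close> dividing \<open>n\<close>, which would force
  \<open>d dvd n\<close>, or some \<open>q - 1\<close>.\<close>

lemma prime_dvd_totientE:
  fixes d n :: nat
  assumes "prime d" and "n > 0" and "d dvd totient n" and "\<not> d dvd n"
  obtains q where "prime q" and "q dvd n" and "d dvd q - 1"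
proof -
  have "d dvd (\<Prod>p\<in>prime_factors n. p ^ (multiplicity p n - 1) * (p - 1))"
    using assms totient_formula1 by simp
  then obtain q where q: "q \<in> prime_factors n"
      and "d dvd q ^ (multiplicity q n - 1) * (q - 1)"
    using prime_dvd_prod_iff[of "prime_factors n" d] \<open>prime d\<close> by auto
  then consider "d dvd q ^ (multiplicity q n - 1)" | "d dvd q - 1"
    using \<open>prime d\<close> prime_dvd_mult_iff by blast
  then show thesis
  proof cases
    case 1
    then have "d dvd q"
      using \<open>prime d\<close> prime_dvd_power by blast
    then show ?thesis
      using q \<open>\<not> d dvd n\<close> by (meson dvd_trans in_prime_factors_iff)
  next
    case 2
    then show ?thesis
      using q that by auto
  qed
qed

text \<open>
  Each prime \<open>p \<ge> 11\<close> contributes a factor \<open>p (1 - 1/p)\<^bsup>10\<^esup> \<ge> 1\<close> to \<open>\<phi>(n)\<^bsup>10\<^esup> / n\<^sup>9\<close>; the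
  constant 8 absorbs \<open>(1/2) (2/3) (4/5) (6/7) = 8/35\<close> from the smaller primes.
\<close>

lemma totient_lower_bound:
  assumes "n > 0"
  shows "real n ^ 9 \<le> (8 * real (totient n)) ^ 10"
proof -
  define S where "S = prime_factors n"
  define T :: "nat set" where "T = {2, 3, 5, 7}"
  define g :: "nat \<Rightarrow> real" where "g p = (1 - 1 / real p) ^ 10" for p
  have g01: "0 \<le> g p" "g p \<le> 1" if "p > 0" for p
    using that by (auto simp: g_def intro!: power_le_one)
  have pos: "p > 0" if "p \<in> S \<union> T" for p
    using that by (auto simp: S_def T_def in_prime_factors_iff intro: prime_gt_0_nat)
  have large: "1 \<le> real p * g p" if "p \<in> S" "p \<notin> T" for p
  proof -
    have "prime p"
      using that by (simp add: S_def in_prime_factors_iff)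
    have "p \<noteq> 0" "p \<noteq> 1" "p \<noteq> 2" "p \<noteq> 3" "p \<noteq> 5" "p \<noteq> 7"
      using that \<open>prime p\<close> by (auto simp: T_def)
    moreover have "p \<noteq> 4" "p \<noteq> 6" "p \<noteq> 8" "p \<noteq> 9" "p \<noteq> 10"
      using \<open>prime p\<close> prime_nat_not_dvd[of p 2] prime_nat_not_dvd[of p 3] by auto
    ultimately have "p \<ge> 11"
      by (intro leI notI) (auto simp: numeral_eq_Suc less_Suc_eq)
    \<comment> \<open>Equivalent to \<open>p \<ge> 11\<close>; hence \<open>T\<close> consists of
      the primes below 11.\<close>
    then have "1 / real p \<le> 1 - 10 / real p"
      by (simp add: field_simps)
    also have "\<dots> \<le> g p"
      using Bernoulli_inequality[of "- 1 / real p" 10] \<open>p \<ge> 11\<close> by (simp add: g_def)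
    finally show ?thesis
      using \<open>p \<ge> 11\<close> by (simp add: field_simps)
  qed
  have "(\<Prod>p\<in>S. real p) = real (\<Prod>p\<in>S. p)"
    by simp
  also have "\<dots> \<le> real n"
  proof -
    have "(\<Prod>p\<in>S. p) dvd (\<Prod>p\<in>S. p ^ multiplicity p n)"
      by (rule prod_dvd_prod) (auto simp: S_def prime_factors_multiplicity intro: dvd_power)
    also have "\<dots> = n"
      using prime_factorization_nat[OF assms] by (simp add: S_def)
    finally show ?thesis
      using assms dvd_imp_le of_nat_mono by blast
  qed
  finally have rad: "(\<Prod>p\<in>S. real p) \<le> real n" .
  have "1 \<le> 8 ^ 10 * (\<Prod>p\<in>T. g p)"
    by (simp add: T_def g_def power_divide)
  also have "(\<Prod>p\<in>T. g p) = (\<Prod>p\<in>S \<inter> T. g p) * (\<Prod>p\<in>T - S. g p)"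
    by (rule prod.Int_Diff[of T g S, unfolded Int_commute[of T S]]) (simp add: T_def)
  \<comment> \<open>Primes of \<open>T\<close> not dividing \<open>n\<close> have factors at most 1,
    so dropping them can only enlarge the product.\<close>
  also have "\<dots> \<le> (\<Prod>p\<in>S \<inter> T. g p)"
    by (intro mult_right_le_one_le prod_nonneg prod_le_1) (use pos g01 in auto)
  also have "\<dots> = (\<Prod>p\<in>S. if p \<in> T then g p else 1)"
    by (subst prod.If_cases) (auto simp: S_def Int_def)
  also have "\<dots> \<le> (\<Prod>p\<in>S. real p * g p)"
  proof (rule prod_mono)
    fix p assume "p \<in> S"
    then have "1 * g p \<le> real p * g p"
      by (intro mult_right_mono) (use pos[of p] g01[of p] in auto)
    then show "0 \<le> (if p \<in> T then g p else 1) \<and> (if p \<in> T then g p else 1) \<le> real p * g p"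
      using large[of p] g01[of p] pos[of p] \<open>p \<in> S\<close> by auto
  qed
  also have "\<dots> = (\<Prod>p\<in>S. real p) * (\<Prod>p\<in>S. g p)"
    by (rule prod.distrib)
  also have "\<dots> \<le> real n * (\<Prod>p\<in>S. g p)"
    by (intro mult_right_mono rad prod_nonneg) (use pos g01 in auto)
  also have "(\<Prod>p\<in>S. g p) = (\<Prod>p\<in>S. 1 - 1 / real p) ^ 10"
    by (simp add: g_def prod_power_distrib)
  finally have "1 \<le> 8 ^ 10 * (real n * (\<Prod>p\<in>S. 1 - 1 / real p) ^ 10)"
    by simp
  \<comment> \<open>The factor \<open>n ^ 9\<close> completes the right side to a tenth power, whose
    base is 8 times the Euler product for the totient.\<close>
  then have "real n ^ 9 * 1 \<le> real n ^ 9 * (8 ^ 10 * (real n * (\<Prod>p\<in>S. 1 - 1 / real p) ^ 10))"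
    by (intro mult_left_mono) auto
  also have "\<dots> = (8 * (real n * (\<Prod>p\<in>S. 1 - 1 / real p))) ^ 10"
    by (simp add: power_mult_distrib eval_nat_numeral)
  finally show ?thesis
    by (simp add: totient_formula2 S_def)
qed

text \<open>A single term of the exponential series at \<open>n\<close>, namely
  \<open>n ^ n / fact n\<close>, is at most the whole sum.\<close>

lemma power_div_exp_le_fact: "(real n / exp 1) ^ n \<le> fact n"
proof -
  have "real n ^ n / fact n \<le> exp (real n)"
    using sum_le_suminf[OF summable_exp_generic[of "real n"], of "{n}"]
    by (simp add: exp_def field_simps)
  then show ?thesis
    by (simp add: power_divide field_simps flip: exp_of_nat_mult)
qed

text \<open>Meant for the case \<open>p = D\<close>. From \<open>d\<close> to \<open>d + 1\<close>
  the right side gains the factor \<open>d * d\<close>, the left side only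
  \<open>d * (1 + 1/d) ^ (d + 2)\<close>, which is at most \<open>5 * d\<close>.\<close>

lemma power_le_square_fact:
  assumes "d \<ge> 5"
  shows "real d ^ (d + 1) \<le> (8 * fact (d - 1)) ^ 2"
  using assms
proof (induction d rule: dec_induct)
  case base
  show ?case by (simp add: fact_numeral)
next
  case (step d)
  have d: "real d \<ge> 5"
    using step by simp
  have "(1 + 1 / real d) ^ d \<le> exp (1 / real d) ^ d"
    using d by (intro power_mono) auto
  also have "\<dots> = exp 1"
    using d by (simp flip: exp_of_nat_mult)
  finally have "(1 + 1 / real d) ^ d * (1 + 1 / real d) ^ 2 \<le> exp 1 * (6 / 5) ^ 2"
    using d by (intro mult_mono power_mono) (auto simp: field_simps)
  also have "\<dots> \<le> 3 * (6 / 5) ^ 2"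
    using exp_le by (intro mult_right_mono) auto
  also have "\<dots> \<le> 5"
    by (simp add: power2_eq_square)
  finally have e: "(1 + 1 / real d) ^ (d + 2) \<le> 5"
    by (simp only: power_add)
  have "real (Suc d) ^ (Suc d + 1) = real d ^ (d + 2) * (1 + 1 / real d) ^ (d + 2)"
    using d by (simp add: field_simps flip: power_mult_distrib power_Suc)
  also have "\<dots> \<le> real d ^ (d + 2) * 5"
    by (intro mult_left_mono e) auto
  also have "\<dots> \<le> real d ^ (d + 1) * real d ^ 2"
    using d by (auto simp: power2_eq_square)
  also have "\<dots> \<le> (8 * fact (d - 1)) ^ 2 * real d ^ 2"
    using step by (intro mult_right_mono) auto
  also have "\<dots> = (8 * fact (Suc d - 1)) ^ 2"
    using step by (cases d) (auto simp: power_mult_distrib)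
  finally show ?case .
qed


section \<open>Lucas sequences with prime discriminant\<close>

text \<open>As \<open>d\<close> is 1 modulo 4, the reciprocity sign is +1, and \<open>q\<close>,
  being 1 modulo \<open>d\<close>, is a square modulo \<open>d\<close>. An odd root is wanted so
  that \<open>b + s\<close> can be halved for odd \<open>b\<close>.\<close>

lemma ex_odd_sqrt_mod_prime:
  fixes d q :: nat
  assumes "prime d" and "d mod 4 = 1" and "prime q" and "d dvd q - 1"
  obtains s :: int where "odd s" and "[s\<^sup>2 = int d] (mod int q)"
proof -
  have "d \<noteq> 2"
    using \<open>d mod 4 = 1\<close> by auto
  then have "d > 2" "q > 1"
    using assms prime_gt_1_nat[of d] prime_gt_1_nat[of q] by linarith+
  then have "q > d"
    using dvd_imp_le[OF \<open>d dvd q - 1\<close>] by simp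
  have "odd q"
    using \<open>q > d\<close> \<open>d > 2\<close> \<open>prime q\<close> prime_odd_nat by auto
  have q1: "[int q = 1] (mod int d)"
    using assms(4) \<open>q > 1\<close> by (simp add: cong_iff_dvd_diff flip: int_dvd_int_iff)
  have "even ((d - 1) div 2)"
    using \<open>d mod 4 = 1\<close> by presburger
  then have "Legendre d q * Legendre q d = 1"
    using Quadratic_Reciprocity[of d q] assms \<open>d > 2\<close> \<open>q > d\<close> by simp
  moreover have "\<not> [int q = 0] (mod int d)"
    using q1 \<open>d > 2\<close> by (simp add: cong_def)
  moreover have "QuadRes d q"
    unfolding QuadRes_def using q1 by (intro exI[of _ 1]) (simp add: cong_sym)
  ultimately have "QuadRes q d"
    by (auto simp: Legendre_def split: if_splits)
  then obtain s where s: "[s\<^sup>2 = int d] (mod int q)"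
    by (auto simp: QuadRes_def)
  show thesis
  proof (cases "odd s")
    case True
    then show ?thesis using s that by blast
  next
    case False
    \<comment> \<open>Adding the odd number \<open>q\<close> changes the parity of the root.\<close>
    have "[(s + int q)\<^sup>2 = s\<^sup>2] (mod int q)"
      by (rule cong_pow) (simp add: cong_def)
    then have "[(s + int q)\<^sup>2 = int d] (mod int q)"
      using s by (rule cong_trans)
    then show ?thesis
      using that[of "s + int q"] False \<open>odd q\<close> by simp
  qed
qed

locale lucas_sequence =
  fixes b c :: nat and u :: "nat \<Rightarrow> nat"
  assumes b_pos: "b > 0" and c_pos: "c > 0"
    and u_0: "u 0 = 0" and u_1: "u (Suc 0) = 1"
    and u_rec: "u (Suc (Suc n)) = b * u (Suc n) + c * u n"
begin

section \<open>Characteristic roots and growth of the sequence\<close>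

definition D :: nat where "D = b\<^sup>2 + 4 * c"
definition \<alpha> :: real where "\<alpha> = (real b + sqrt (real D)) / 2"
definition \<beta> :: real where "\<beta> = (real b - sqrt (real D)) / 2"

lemma D_ge_5: "D \<ge> 5"
proof -
  have "b\<^sup>2 \<ge> 1"
    using b_pos by simp
  then show ?thesis
    using c_pos by (simp add: D_def)
qed

lemma sqrt_D_gt_2: "sqrt (real D) > 2"
  using D_ge_5 by (intro real_less_rsqrt) auto

lemma b_less_sqrt_D: "real b < sqrt (real D)"
  using c_pos by (intro real_less_rsqrt) (simp add: D_def)

lemma alpha_gt: "\<alpha> > 3 / 2"
  using sqrt_D_gt_2 b_pos by (simp add: \<alpha>_def)

lemma alpha_less_sqrt_D: "\<alpha> < sqrt (real D)"
  using b_less_sqrt_D by (simp add: \<alpha>_def)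

lemma beta_neg: "\<beta> < 0"
  using b_less_sqrt_D by (simp add: \<beta>_def)

lemma b_less_alpha: "real b < \<alpha>"
  using b_less_sqrt_D by (simp add: \<alpha>_def)

lemma alpha_square: "\<alpha>\<^sup>2 = real b * \<alpha> + real c"
  by (simp add: \<alpha>_def D_def power2_eq_square field_simps)

lemma beta_square: "\<beta>\<^sup>2 = real b * \<beta> + real c"
  by (simp add: \<beta>_def D_def power2_eq_square field_simps)

lemma u_pos: "n > 0 \<Longrightarrow> u n > 0"
  by (induction n rule: induct_nat_012) (auto simp: u_1 u_rec b_pos)

lemma u_le: "real (u (Suc n)) \<le> \<alpha> ^ n"
proof (induction n rule: induct_nat_012)
  case (ge2 n)
  have "real (u (Suc (Suc (Suc n)))) = b * real (u (Suc (Suc n))) + c * real (u (Suc n))"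
    by (simp add: u_rec)
  also have "\<dots> \<le> b * \<alpha> ^ Suc n + c * \<alpha> ^ n"
    using ge2 by (intro add_mono mult_left_mono) auto
  also have "\<dots> = \<alpha> ^ n * \<alpha>\<^sup>2"
    by (simp add: alpha_square algebra_simps)
  finally show ?case
    by (simp add: power2_eq_square mult_ac)
qed (use b_less_alpha in \<open>auto simp: u_0 u_1 u_rec\<close>)

lemma binet: "sqrt (real D) * real (u n) = \<alpha> ^ n - \<beta> ^ n"
proof (induction n rule: induct_nat_012)
  case (ge2 n)
  have "sqrt (real D) * real (u (Suc (Suc n))) =
      real b * (sqrt (real D) * real (u (Suc n))) + real c * (sqrt (real D) * real (u n))"
    by (simp add: u_rec algebra_simps)
  also have "\<dots> = \<alpha> ^ n * \<alpha>\<^sup>2 - \<beta> ^ n * \<beta>\<^sup>2"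
    unfolding ge2 alpha_square beta_square by (simp add: algebra_simps)
  finally show ?case
    by (simp add: power2_eq_square mult_ac)
qed (auto simp: u_0 u_1 \<alpha>_def \<beta>_def field_simps)

text \<open>For odd \<open>n\<close> the term \<open>- \<beta> ^ n\<close> in Binet's formula is
  positive.\<close>

lemma u_ge_odd:
  assumes "odd n"
  shows "\<alpha> ^ n \<le> sqrt (real D) * real (u n)"
  using binet[of n] beta_neg assms by (simp add: power_less_zero_eq less_imp_le)

text \<open>Modulo \<open>D\<close> the characteristic polynomial has the double root
  \<open>b/2\<close>, so \<open>u (n + 1)\<close> becomes \<open>(n + 1) * (b/2) ^ n\<close>; the
  power of 2 clears denominators.\<close>

lemma u_cong_discriminant: "[2 ^ n * int (u (Suc n)) = int (Suc n) * int b ^ n] (mod int D)"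
proof (induction n rule: induct_nat_012)
  case (ge2 n)
  have "[4 * int c = - (int b)\<^sup>2] (mod int D)"
    by (simp add: cong_iff_dvd_diff D_def add.commute)
  then have "[int b * 2 * (2 ^ Suc n * int (u (Suc (Suc n)))) + 4 * int c * (2 ^ n * int (u (Suc n)))
      = int b * 2 * (int (Suc (Suc n)) * int b ^ Suc n) + - (int b)\<^sup>2 * (int (Suc n) * int b ^ n)]
      (mod int D)"
    by (intro cong_add cong_mult[OF cong_refl] cong_mult[of "4 * int c"] ge2)
  then show ?case
    by (simp add: u_rec power2_eq_square algebra_simps)
qed (auto simp: u_0 u_1 u_rec)

section \<open>Divisors of the sequence when the discriminant is prime\<close>

context
  assumes prime_D: "prime D"
begin

lemma odd_D: "odd D"
  using prime_D D_ge_5 prime_odd_nat by auto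

lemma D_mod_4: "D mod 4 = 1"
proof -
  have "odd b"
    using odd_D by (simp add: D_def)
  then obtain k where "b = 2 * k + 1"
    by (rule oddE)
  then have "D = 1 + 4 * (k * k + k + c)"
    unfolding D_def by (simp add: power2_eq_square algebra_simps)
  then show ?thesis
    by simp
qed

text \<open>The congruence modulo \<open>D\<close> puts \<open>D\<close> into
  \<open>n * b ^ (n - 1)\<close>, and \<open>0 < b < D\<close> keeps it out of
  \<open>b\<close>.\<close>

lemma discriminant_dvd_u_imp:
  assumes "D dvd u n"
  shows "D dvd n"
proof (cases n)
  case (Suc m)
  have "b < D"
    using c_pos le_square[of b] unfolding D_def power2_eq_square by linarith
  then have "\<not> int D dvd int b"
    using b_pos by (simp add: nat_dvd_not_less)
  have "int D dvd 2 ^ m * int (u (Suc m))"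
    using assms Suc by simp
  then have "int D dvd int (Suc m) * int b ^ m"
    using u_cong_discriminant[of m] cong_trans cong_sym by (metis cong_0_iff)
  then show ?thesis
    using \<open>\<not> int D dvd int b\<close> prime_D Suc prime_dvd_mult_iff prime_dvd_power
    by (metis int_dvd_int_iff prime_nat_int_transfer)
qed simp

lemma prime_divisor_u_cong:
  assumes "prime q" and "D dvd q - 1" and "prime p" and "q dvd u p"
  shows "p dvd q - 1"
proof -
  have "q > 1"
    using \<open>prime q\<close> prime_gt_1_nat by blast
  then have "q > D"
    using dvd_imp_le[OF \<open>D dvd q - 1\<close>] by simp
  then have "odd q"
    using D_ge_5 \<open>prime q\<close> prime_odd_nat by auto
  have primeq: "prime (int q)"
    using \<open>prime q\<close> by simp
  obtain s where "odd s" and s: "[s\<^sup>2 = int D] (mod int q)"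
    using ex_odd_sqrt_mod_prime[OF prime_D D_mod_4 \<open>prime q\<close> \<open>D dvd q - 1\<close>] .
  have "\<not> int q dvd s"
  proof
    assume "int q dvd s"
    then have "int q dvd s\<^sup>2"
      by (simp add: power2_eq_square)
    then have "int q dvd int D"
      using s cong_trans cong_sym by (metis cong_0_iff)
    then show False
      using \<open>q > D\<close> D_ge_5 by (simp add: nat_dvd_not_less)
  qed
  \<comment> \<open>\<open>x\<close> and \<open>y\<close> are the roots of \<open>X\<^sup>2 - bX - c\<close> modulo \<open>q\<close>.\<close>
  define x where "x = (int b + s) div 2"
  define y where "y = int b - x"
  have "odd b"
    using odd_D by (simp add: D_def)
  then have x2: "2 * x = int b + s"
    using \<open>odd s\<close> by (simp add: x_def)
  then have xy: "x - y = s"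
    by (simp add: y_def)
  \<comment> \<open>Completing the square; the factor 4 is then cancelled because \<open>q\<close>
    is odd.\<close>
  have "4 * (x\<^sup>2 - (int b * x + int c)) = (2 * x - int b)\<^sup>2 - int D"
    by (simp add: D_def power2_eq_square algebra_simps)
  also have "\<dots> = s\<^sup>2 - int D"
    using x2 by simp
  finally have "int q dvd 4 * (x\<^sup>2 - (int b * x + int c))"
    using s by (simp add: cong_iff_dvd_diff)
  moreover have "coprime (int q) 4"
    using \<open>odd q\<close> coprime_power_right_iff[of "int q" 2 2] by simp
  ultimately have root_x: "[x\<^sup>2 = int b * x + int c] (mod int q)"
    by (simp only: cong_iff_dvd_diff coprime_dvd_mult_right_iff)
  have "y\<^sup>2 - (int b * y + int c) = x\<^sup>2 - (int b * x + int c)"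
    by (simp add: y_def power2_eq_square algebra_simps)
  then have root_y: "[y\<^sup>2 = int b * y + int c] (mod int q)"
    using root_x by (simp only: cong_iff_dvd_diff)
  have "[x ^ n - y ^ n = (x - y) * int (u n)] (mod int q)" for n
  proof (induction n rule: induct_nat_012)
    case (ge2 n)
    have "[x ^ n * x\<^sup>2 - y ^ n * y\<^sup>2
        = x ^ n * (int b * x + int c) - y ^ n * (int b * y + int c)] (mod int q)"
      by (intro cong_diff cong_mult cong_refl root_x root_y)
    also have "x ^ n * (int b * x + int c) - y ^ n * (int b * y + int c)
        = int b * (x ^ Suc n - y ^ Suc n) + int c * (x ^ n - y ^ n)"
      by (simp add: algebra_simps)
    also have "[\<dots> = int b * ((x - y) * int (u (Suc n))) + int c * ((x - y) * int (u n))] (mod int q)"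
      by (intro cong_add cong_mult cong_refl ge2)
    finally show ?case
      by (simp add: u_rec power2_eq_square algebra_simps)
  qed (auto simp: u_0 u_1)
  from this[of p] have "int q dvd x ^ p - y ^ p"
    using \<open>q dvd u p\<close> cong_trans by (metis cong_0_iff dvd_mult int_dvd_int_iff)
  then have pow: "[x ^ p = y ^ p] (mod int q)"
    by (simp add: cong_iff_dvd_diff)
  have "p > 0"
    using \<open>prime p\<close> prime_gt_0_nat by blast
  have "\<not> int q dvd y"
  proof
    assume "int q dvd y"
    then have "int q dvd x ^ p"
      using pow \<open>p > 0\<close> cong_trans by (metis cong_0_iff dvd_power dvd_trans)
    then have "int q dvd x"
      using primeq prime_dvd_power by blast
    then show False
      using \<open>int q dvd y\<close> \<open>\<not> int q dvd s\<close> xy dvd_diff by blast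
  qed
  then have "coprime y (int q)"
    using primeq prime_imp_coprime coprime_commute by blast
  then obtain w where w: "[y * w = 1] (mod int q)"
    using cong_solve_coprime_int by blast
  \<comment> \<open>\<open>z\<close> is a natural number representing the quotient
    \<open>x/y\<close> modulo \<open>q\<close>.\<close>
  define z where "z = nat ((x * w) mod int q)"
  have z: "[int z = x * w] (mod int q)"
    using \<open>q > 1\<close> by (simp add: z_def cong_def)
  have "[int z ^ p = x ^ p * w ^ p] (mod int q)"
    using cong_pow[OF z] by (simp add: power_mult_distrib)
  also have "[x ^ p * w ^ p = y ^ p * w ^ p] (mod int q)"
    by (intro cong_mult pow cong_refl)
  also have "[y ^ p * w ^ p = 1] (mod int q)"
    using cong_pow[OF w, of p] by (simp add: power_mult_distrib)
  finally have "[z ^ p = 1] (mod q)"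
    by (simp flip: cong_int_iff)
  then have ord: "ord q z dvd p"
    by (simp only: ord_divides)
  \<comment> \<open>Order 1 would give \<open>x = y\<close> modulo \<open>q\<close>, but
    \<open>x - y = s\<close> is not divisible by \<open>q\<close>.\<close>
  have "ord q z \<noteq> 1"
  proof
    assume "ord q z = 1"
    then have "[z ^ 1 = 1] (mod q)"
      by (simp only: ord_divides) simp
    then have "[int z = 1] (mod int q)"
      by (simp flip: cong_int_iff)
    then have "[x * w = 1] (mod int q)"
      using z cong_trans cong_sym by blast
    then have "[x * w * y = 1 * y] (mod int q)"
      by (intro cong_mult cong_refl)
    moreover have "[x * (y * w) = x * 1] (mod int q)"
      by (intro cong_mult w cong_refl)
    moreover have "x * (y * w) = x * w * y"
      by simp
    ultimately have "[x = y] (mod int q)"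
      using cong_trans cong_sym by (metis mult_1 mult_1_right)
    then show False
      using xy \<open>\<not> int q dvd s\<close> by (simp add: cong_iff_dvd_diff)
  qed
  with ord \<open>prime p\<close> have "ord q z = p"
    by (auto simp: prime_nat_iff)
  \<comment> \<open>The order is 0 exactly when \<open>q\<close> and \<open>z\<close> are not
    coprime.\<close>
  moreover have "coprime q z"
    using calculation \<open>p > 0\<close> ord_eq_0[of q z] by auto
  ultimately show ?thesis
    using order_divides_totient[of q z] \<open>prime q\<close> by (simp add: totient_prime)
qed

end

end

section \<open>Bounding \<open>p\<close> by comparing \<open>k\<close> with the discriminant\<close>

theorem theorem3:
  fixes a b c :: nat and u :: "nat \<Rightarrow> nat"
  assumes "a > 0" and "b > 0" and "c > 0"
    and "prime (b\<^sup>2 + 4 * c)" and "b\<^sup>2 + 4 * c > a"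
    and "u 0 = 0" and "u 1 = 1"
    and "\<And>n. n \<ge> 2 \<Longrightarrow> u n = b * u (n - 1) + c * u (n - 2)"
  shows "finite {p :: nat. prime p \<and> (\<exists>k :: nat. k > 0 \<and> totient (a * u p) = fact k)} \<and>
    (\<forall>p :: nat. prime p \<and> (\<exists>k :: nat. k > 0 \<and> totient (a * u p) = fact k) \<longrightarrow>
      real p \<le> max
        (exp 1 * real a powr (1 / 2) * ((real b + sqrt (real (b\<^sup>2 + 4 * c))) / 2))
        ((10 / 9 * ln (8 * real (fact (b\<^sup>2 + 4 * c - 1))) - ln (real a)
            + ln (real (b\<^sup>2 + 4 * c)) / 2)
          / ln ((real b + sqrt (real (b\<^sup>2 + 4 * c))) / 2)))"
proof -
  interpret lucas_sequence b c u
    using assms by unfold_locales auto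
  have D_fold: "b\<^sup>2 + 4 * c = D"
    by (simp add: D_def)
  have alpha_fold: "(real b + sqrt (real D)) / 2 = \<alpha>"
    by (simp add: \<alpha>_def)
  have prime_D: "prime D" and "a < D"
    using assms by (simp_all add: D_def)
  define B1 where "B1 = exp 1 * real a powr (1 / 2) * \<alpha>"
  define B2 where "B2 = (10 / 9 * ln (8 * real (fact (D - 1))) - ln (real a) + ln (real D) / 2) / ln \<alpha>"
  have ln_alpha: "ln \<alpha> > 0"
    using alpha_gt by simp
  have sqrt_a: "real a powr (1 / 2) \<ge> 1"
    using \<open>a > 0\<close> by (simp add: ge_one_powr_ge_zero)
  have e2: "exp 1 \<ge> (2 :: real)"
    using exp_ge_add_one_self[of 1] by simp
  have bound: "real p \<le> max B1 B2" if "prime p" and tot: "totient (a * u p) = fact k" for p k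
  proof -
    have "p > 0"
      using \<open>prime p\<close> prime_gt_0_nat by blast
    then have upos: "a * u p > 0"
      using u_pos \<open>a > 0\<close> by simp
    \<comment> \<open>The case \<open>k < D\<close> relies on a lower bound for \<open>u p\<close>
      valid for odd \<open>p\<close>, so 2 is treated apart. The cases \<open>p = 2\<close> and
      \<open>p = D\<close> are settled whatever \<open>k\<close> is.\<close>
    consider "p = 2" | "p = D" | "k \<ge> D" "p \<noteq> D" | "k < D" "odd p"
      using prime_odd_nat[OF \<open>prime p\<close>] prime_ge_2_nat[OF \<open>prime p\<close>] by linarith
    then show ?thesis
    proof cases
      case 1
      have "2 * 1 * (3 / 2) \<le> B1"
        unfolding B1_def using sqrt_a e2 alpha_gt by (intro mult_mono) auto
      then show ?thesis
        using 1 by simp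
    next
      case 2
      \<comment> \<open>Since \<open>\<alpha> < sqrt D\<close> and \<open>a < D\<close>, the second
        bound follows from \<open>(D + 1) / 2 * ln D \<le> ln (8 * fact (D - 1))\<close>.\<close>
      have "real (D + 1) * ln (real D) = ln (real D ^ (D + 1))"
        using D_ge_5 by (subst ln_realpow) auto
      also have "\<dots> \<le> ln ((8 * fact (D - 1)) ^ 2)"
        using power_le_square_fact[OF D_ge_5] D_ge_5 by (intro ln_mono) auto
      also have "\<dots> = 2 * ln (8 * fact (D - 1))"
        by (subst ln_realpow) auto
      finally have "(real D + 1) * ln (real D) \<le> 2 * ln (8 * fact (D - 1))"
        by (simp add: add.commute)
      moreover have "ln (real a) \<le> ln (real D)"
        using \<open>a > 0\<close> \<open>a < D\<close> by simp
      moreover have "ln (8 * fact (D - 1) :: real) \<ge> 0"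
        using fact_ge_1[of "D - 1", where 'a = real] by (intro ln_ge_zero) linarith
      moreover have "real D * ln \<alpha> \<le> real D * (ln (real D) / 2)"
        using alpha_less_sqrt_D alpha_gt D_ge_5 by (intro mult_left_mono) (auto simp flip: ln_sqrt)
      ultimately have "real D * ln \<alpha> \<le> 10 / 9 * ln (8 * fact (D - 1)) - ln (real a) + ln (real D) / 2"
        by (simp only: distrib_right)
      then have "real D \<le> B2"
        using ln_alpha by (simp add: B2_def field_simps)
      then show ?thesis
        using 2 by simp
    next
      case 3
      have "D dvd totient (a * u p)"
        using tot 3 D_ge_5 by (simp add: dvd_fact)
      moreover have "\<not> D dvd a * u p"
      proof
        assume "D dvd a * u p"
        moreover have "\<not> D dvd a"
          using \<open>a < D\<close> \<open>a > 0\<close> by (simp add: nat_dvd_not_less)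
        ultimately have "D dvd p"
          using prime_D prime_dvd_mult_iff discriminant_dvd_u_imp[OF prime_D] by blast
        then show False
          using primes_dvd_imp_eq[OF prime_D \<open>prime p\<close>] 3 by simp
      qed
      ultimately obtain q where q: "prime q" "q dvd a * u p" "D dvd q - 1"
        using prime_dvd_totientE[OF prime_D upos] by blast
      have "q > 1"
        using q prime_gt_1_nat by blast
      then have "q > D"
        using dvd_imp_le[OF \<open>D dvd q - 1\<close>] by simp
      then have "\<not> q dvd a"
        using \<open>a < D\<close> \<open>a > 0\<close> by (simp add: nat_dvd_not_less)
      then have "q dvd u p"
        using q prime_dvd_mult_iff by blast
      then have "p dvd q - 1"
        using prime_divisor_u_cong[OF prime_D] q \<open>prime p\<close> by blast
      also have "q - 1 dvd totient (a * u p)"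
        using totient_dvd[OF \<open>q dvd a * u p\<close>] totient_prime[OF \<open>prime q\<close>] by simp
      finally have "p \<le> k"
        using tot \<open>prime p\<close> prime_dvd_fact_iff by simp
      have "(real p / exp 1) ^ p \<le> fact p"
        by (rule power_div_exp_le_fact)
      also have "\<dots> \<le> fact k"
        using \<open>p \<le> k\<close> by (rule fact_mono)
      also have "\<dots> = real (totient (a * u p))"
        by (simp add: tot)
      also have "\<dots> \<le> real a * real (u p)"
        using totient_le[of "a * u p"] of_nat_mono by fastforce
      also have "\<dots> \<le> real a * \<alpha> ^ p"
      proof (intro mult_left_mono)
        have "real (u p) \<le> \<alpha> ^ (p - 1)"
          using u_le[of "p - 1"] \<open>p > 0\<close> by simp
        also have "\<dots> \<le> \<alpha> ^ p"
          using alpha_gt by (intro power_increasing) auto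
        finally show "real (u p) \<le> \<alpha> ^ p" .
      qed simp
      \<comment> \<open>As \<open>p \<ge> 2\<close> and \<open>a \<ge> 1\<close>, \<open>a\<close>
        is at most the \<open>p\<close>-th power of its square root; taking \<open>p\<close>-th
        roots then yields \<open>B1\<close>.\<close>
      also have "\<dots> \<le> (real a powr (1 / 2)) ^ p * \<alpha> ^ p"
      proof (intro mult_right_mono)
        have "real a = (real a powr (1 / 2)) ^ 2"
          using \<open>a > 0\<close> by (simp add: powr_half_sqrt)
        also have "\<dots> \<le> (real a powr (1 / 2)) ^ p"
          using sqrt_a prime_ge_2_nat[OF \<open>prime p\<close>] by (rule power_increasing[rotated])
        finally show "real a \<le> (real a powr (1 / 2)) ^ p" .
      qed (use alpha_gt in auto)
      also have "\<dots> = (real a powr (1 / 2) * \<alpha>) ^ p"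
        by (simp add: power_mult_distrib)
      finally have "real p / exp 1 \<le> real a powr (1 / 2) * \<alpha>"
        using \<open>p > 0\<close> alpha_gt by (subst (asm) power_mono_iff) auto
      then have "real p \<le> B1"
        by (simp add: B1_def field_simps)
      then show ?thesis
        by simp
    next
      case 4
      have "real (a * u p) ^ 9 \<le> (8 * real (totient (a * u p))) ^ 10"
        by (rule totient_lower_bound[OF upos])
      also have "\<dots> \<le> (8 * fact (D - 1)) ^ 10"
        using 4 by (intro power_mono mult_left_mono) (auto simp: tot intro!: fact_mono)
      finally have "ln (real (a * u p) ^ 9) \<le> ln ((8 * fact (D - 1)) ^ 10)"
        using upos by (intro ln_mono) auto
      also have "ln (real (a * u p) ^ 9) = 9 * ln (real (a * u p))"
        using upos by (subst ln_realpow) auto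
      also have "ln ((8 * fact (D - 1) :: real) ^ 10) = 10 * ln (8 * fact (D - 1))"
        by (subst ln_realpow) auto
      also have "ln (real (a * u p)) = ln (real a) + ln (real (u p))"
        using upos by (simp add: ln_mult)
      finally have upper: "9 * (ln (real a) + ln (real (u p))) \<le> 10 * ln (8 * fact (D - 1))" .
      \<comment> \<open>A lower bound for \<open>ln (u p)\<close>, to be played against
        \<open>upper\<close>; the term \<open>ln D / 2\<close> is the logarithm of the denominator
        in Binet's formula.\<close>
      have "real p * ln \<alpha> = ln (\<alpha> ^ p)"
        using alpha_gt by (subst ln_realpow) auto
      also have "\<dots> \<le> ln (sqrt (real D) * real (u p))"
        using u_ge_odd[OF \<open>odd p\<close>] alpha_gt by (intro ln_mono) auto
      also have "\<dots> = ln (real D) / 2 + ln (real (u p))"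
        using upos D_ge_5 by (simp add: ln_mult ln_sqrt)
      finally have "real p * ln \<alpha> \<le> 10 / 9 * ln (8 * fact (D - 1)) - ln (real a) + ln (real D) / 2"
        using upper by simp
      then have "real p \<le> B2"
        using ln_alpha by (simp add: B2_def field_simps)
      then show ?thesis
        by simp
    qed
  qed
  then have "{p. prime p \<and> (\<exists>k>0. totient (a * u p) = fact k)} \<subseteq> {..nat \<lfloor>max B1 B2\<rfloor>}"
    by (auto simp: le_nat_floor)
  then have "finite {p. prime p \<and> (\<exists>k>0. totient (a * u p) = fact k)}"
    by (rule finite_subset) simp
  then show ?thesis
    using bound unfolding D_fold alpha_fold B1_def B2_def by blast
qed

end
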